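(* Let $P(u)=a_0+a_1u+\cdots+a_nu^n$ be a polynomial with all coefficients non-negative and at least one strictly positive, and let $D:[0,\infty)\to\mathbb{R}$ be the function determined by $D\big(\int_0^{z}P(\xi)\,d\xi\big)=P(z)$ for all $z\ge 0$. Let $u\ge 0$ and $v$ be functions of class $\mathcal{C}^{2,1}$ of $(x,t)$, $x\in\mathbb{R}^d$, on an open set of $\mathbb{R}^{d}\times\mathbb{R}$, related by $$v(x,t)=\int_0^{u(x,t)}P(\xi)\,d\xi .$$ Then $$\frac{\partial v}{\partial t}-D(v)\Delta v=\frac{\partial v}{\partial t}-P(u)\Delta v=P(u)\left(\frac{\partial u}{\partial t}-\nabla\cdot\big(P(u)\nabla u\big)\right).$$
   Context: $\mathcal{C}^{2,1}$ is the class of functions having continuous second derivatives with respect to $x$ and continuous first derivative with respect to $t$. $\Delta$, $\nabla$, $\nabla\cdot$ act in the spatial variable $x\in\mathbb{R}^d$. *)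

theory Defs
  imports "HOL-Analysis.Analysis" "HOL-Computational_Algebra.Polynomial"
begin

text \<open>A function of \<open>(x, t)\<close> is a function on the product type \<open>(real^'d) \<times> real\<close>. Partial
  derivatives are derivatives at \<open>0\<close> along the corresponding coordinate line, so at a point of an
  open set they depend only on the values in that open set.\<close>

definition x_slice :: "'d \<Rightarrow> ((real^'d) \<times> real \<Rightarrow> real) \<Rightarrow> (real^'d) \<times> real \<Rightarrow> real \<Rightarrow> real" where
  "x_slice i f p = (\<lambda>s. f (fst p + s *\<^sub>R axis i 1, snd p))"

definition t_slice :: "((real^'d) \<times> real \<Rightarrow> real) \<Rightarrow> (real^'d) \<times> real \<Rightarrow> real \<Rightarrow> real" where
  "t_slice f p = (\<lambda>s. f (fst p, snd p + s))"

definition partial_x :: "'d \<Rightarrow> ((real^'d) \<times> real \<Rightarrow> real) \<Rightarrow> (real^'d) \<times> real \<Rightarrow> real" where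
  "partial_x i f p = deriv (x_slice i f p) 0"

definition partial_t :: "((real^'d) \<times> real \<Rightarrow> real) \<Rightarrow> (real^'d) \<times> real \<Rightarrow> real" where
  "partial_t f p = deriv (t_slice f p) 0"

definition grad_x :: "((real^'d) \<times> real \<Rightarrow> real) \<Rightarrow> (real^'d) \<times> real \<Rightarrow> real^'d" where
  "grad_x f p = (\<chi> i. partial_x i f p)"

definition div_x :: "((real^'d) \<times> real \<Rightarrow> real^'d) \<Rightarrow> (real^'d) \<times> real \<Rightarrow> real" where
  "div_x F p = (\<Sum>i\<in>UNIV. partial_x i (\<lambda>q. F q $ i) p)"

definition laplacian_x :: "((real^'d) \<times> real \<Rightarrow> real) \<Rightarrow> (real^'d) \<times> real \<Rightarrow> real" where
  "laplacian_x f p = (\<Sum>i\<in>UNIV. partial_x i (partial_x i f) p)"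

text \<open>On an open set, continuity of \<open>f\<close> and of its first spatial derivatives follows from the
  conditions below and is therefore not demanded separately.\<close>

definition C21_on :: "((real^'d) \<times> real) set \<Rightarrow> ((real^'d) \<times> real \<Rightarrow> real) \<Rightarrow> bool" where
  "C21_on \<Omega> f \<longleftrightarrow>
     (\<forall>p\<in>\<Omega>. \<forall>i. x_slice i f p differentiable (at 0)) \<and>
     (\<forall>p\<in>\<Omega>. \<forall>i j. x_slice j (partial_x i f) p differentiable (at 0)) \<and>
     (\<forall>i j. continuous_on \<Omega> (partial_x j (partial_x i f))) \<and>
     (\<forall>p\<in>\<Omega>. t_slice f p differentiable (at 0)) \<and>
     continuous_on \<Omega> (partial_t f)"

end

theory Submission
  imports Defs
begin

text \<open>By the chain rule \<open>\<partial>\<^sub>t v = P(u) \<partial>\<^sub>t u\<close> and \<open>\<nabla>v = P(u) \<nabla>u\<close> throughout the open set. Since partial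
  derivatives are local, \<open>\<Delta>v = \<nabla>\<cdot>(P(u) \<nabla>u)\<close>. Replacing the integral by a polynomial antiderivative,
  which is differentiable on all of \<open>\<real>\<close>, avoids one-sided derivatives at points where \<open>u = 0\<close>.\<close>

text \<open>Termwise integration: differentiating the term of degree \<open>Suc k\<close> brings
  down \<open>of_nat (Suc k)\<close>, which cancels the denominator because it is nonzero in
  characteristic 0.\<close>

lemma pderiv_surj: "\<exists>Q. pderiv Q = (P :: 'a::field_char_0 poly)"
proof
  let ?Q = "\<Sum>k\<le>degree P. monom (coeff P k / of_nat (Suc k)) (Suc k)"
  have "pderiv ?Q = (\<Sum>k\<le>degree P. monom (coeff P k) k)"
    unfolding additive.sum[OF additive.intro[OF pderiv_add]] by (intro sum.cong refl) (simp add: pderiv_monom del: of_nat_Suc)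
  then show "pderiv ?Q = P"
    by (simp add: poly_as_sum_of_monoms)
qed

lemma integral_poly_pderiv:
  fixes Q :: "real poly"
  assumes "a \<le> b"
  shows "integral {a..b} (poly (pderiv Q)) = poly Q b - poly Q a"
  by (intro integral_unique fundamental_theorem_of_calculus assms)
    (auto simp flip: has_real_derivative_iff_has_vector_derivative
      intro: DERIV_subset[OF poly_DERIV])

text \<open>This makes partial derivatives local: a short piece of the coordinate line through
  \<open>p\<close> stays in the open set. The filter is \<open>nhds 0\<close>, including
  \<open>s = 0\<close>, since a derivative also depends on the value at the point itself.\<close>

lemma eventually_x_slice:
  fixes p :: "(real^'d) \<times> real"
  assumes "open \<Omega>" "p \<in> \<Omega>"
  shows "\<forall>\<^sub>F s in nhds 0. (fst p + s *\<^sub>R axis i 1, snd p) \<in> \<Omega>"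
proof -
  have "((\<lambda>s::real. (fst p + s *\<^sub>R axis i 1, snd p)) \<longlongrightarrow> (fst p + 0 *\<^sub>R axis i 1, snd p)) (nhds 0)"
    by (intro tendsto_intros filterlim_ident)
  with assms show ?thesis
    by (intro topological_tendstoD) auto
qed

lemma eventually_t_slice:
  assumes "open \<Omega>" "p \<in> \<Omega>"
  shows "\<forall>\<^sub>F s in nhds (0::real). (fst p, snd p + s) \<in> \<Omega>"
proof -
  have "((\<lambda>s::real. (fst p, snd p + s)) \<longlongrightarrow> (fst p, snd p + 0)) (nhds 0)"
    by (intro tendsto_intros filterlim_ident)
  with assms show ?thesis
    by (intro topological_tendstoD) auto
qed

lemma partial_x_cong:
  assumes "open \<Omega>" "p \<in> \<Omega>" "\<And>q. q \<in> \<Omega> \<Longrightarrow> f q = g q"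
  shows "partial_x i f p = partial_x i g p"
  unfolding partial_x_def x_slice_def
  using eventually_mono[OF eventually_x_slice[OF assms(1,2)] assms(3)]
  by (intro deriv_cong_ev refl)

lemma partial_t_cong:
  assumes "open \<Omega>" "p \<in> \<Omega>" "\<And>q. q \<in> \<Omega> \<Longrightarrow> f q = g q"
  shows "partial_t f p = partial_t g p"
  unfolding partial_t_def t_slice_def
  using eventually_mono[OF eventually_t_slice[OF assms(1,2)] assms(3)]
  by (intro deriv_cong_ev refl)

text \<open>Differentiability of \<open>f\<close> is assumed because \<open>deriv\<close> is an
  arbitrary value without it; the slices of a \<open>C21_on\<close> function supply it.\<close>

lemma deriv_comp_at_0:
  fixes f g :: "real \<Rightarrow> real"
  assumes "f differentiable (at 0)" "(g has_real_derivative g') (at (f 0))"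
  shows "deriv (\<lambda>s. g (f s)) 0 = g' * deriv f 0"
proof -
  have "(f has_real_derivative deriv f 0) (at 0)"
    using assms(1) real_differentiable_def DERIV_deriv_iff_real_differentiable by blast
  from DERIV_chain2[OF assms(2) this] show ?thesis
    by (rule DERIV_imp_deriv)
qed

lemma partial_x_comp:
  assumes "x_slice i u p differentiable (at 0)" "(g has_real_derivative g') (at (u p))"
  shows "partial_x i (\<lambda>q. g (u q)) p = g' * partial_x i u p"
  using deriv_comp_at_0[OF assms(1), of g g'] assms(2)
  by (simp add: partial_x_def x_slice_def)

lemma partial_t_comp:
  assumes "t_slice u p differentiable (at 0)" "(g has_real_derivative g') (at (u p))"
  shows "partial_t (\<lambda>q. g (u q)) p = g' * partial_t u p"
  using deriv_comp_at_0[OF assms(1), of g g'] assms(2)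
  by (simp add: partial_t_def t_slice_def)

theorem lemma1:
  fixes P :: "real poly" and D :: "real \<Rightarrow> real"
    and \<Omega> :: "((real^'d) \<times> real) set"
    and u v :: "(real^'d) \<times> real \<Rightarrow> real"
  assumes coeff_nonneg: "\<And>k. coeff P k \<ge> 0"
    and coeff_pos: "\<exists>k. coeff P k > 0"
    and D: "\<And>z. z \<ge> 0 \<Longrightarrow> D (integral {0..z} (poly P)) = poly P z"
    and "open \<Omega>"
    and u_C21: "C21_on \<Omega> u" and v_C21: "C21_on \<Omega> v"
    and u_nonneg: "\<And>p. p \<in> \<Omega> \<Longrightarrow> u p \<ge> 0"
    and v_eq: "\<And>p. p \<in> \<Omega> \<Longrightarrow> v p = integral {0..u p} (poly P)"
  shows "\<forall>p\<in>\<Omega>.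
      partial_t v p - D (v p) * laplacian_x v p
        = partial_t v p - poly P (u p) * laplacian_x v p \<and>
      partial_t v p - poly P (u p) * laplacian_x v p
        = poly P (u p) * (partial_t u p - div_x (\<lambda>q. poly P (u q) *\<^sub>R grad_x u q) p)"
proof
  fix p assume p: "p \<in> \<Omega>"
  obtain Q where Q: "pderiv Q = P"
    using pderiv_surj by blast
  \<comment> \<open>\<open>Q\<close> is fixed only up to a constant; subtracting
    \<open>poly Q 0\<close> gives the antiderivative vanishing at 0, which equals the integral from
    0 to \<open>z\<close> for z \<ge> 0.\<close>
  define F where "F z = poly Q z - poly Q 0" for z
  have F_deriv: "(F has_real_derivative poly P z) (at z)" for z
    unfolding F_def using Q by (auto intro!: derivative_eq_intros)
  have v_F: "v q = F (u q)" if "q \<in> \<Omega>" for q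
    using integral_poly_pderiv[OF u_nonneg[OF that], of Q] v_eq[OF that] Q by (simp add: F_def)
  \<comment> \<open>Proved at every point of \<open>\<Omega>\<close>, not just at \<open>p\<close>,
    so that the identity can be differentiated once more.\<close>
  have v_x: "partial_x i v q = poly P (u q) * partial_x i u q" if q: "q \<in> \<Omega>" for i q
  proof -
    have "partial_x i v q = partial_x i (\<lambda>q. F (u q)) q"
      using \<open>open \<Omega>\<close> q v_F by (rule partial_x_cong)
    also have "\<dots> = poly P (u q) * partial_x i u q"
      using u_C21 q F_deriv by (intro partial_x_comp) (auto simp: C21_on_def)
    finally show ?thesis .
  qed
  have "partial_t v p = partial_t (\<lambda>q. F (u q)) p"
    using \<open>open \<Omega>\<close> p v_F by (rule partial_t_cong)
  also have "\<dots> = poly P (u p) * partial_t u p"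
    using u_C21 p F_deriv by (intro partial_t_comp) (auto simp: C21_on_def)
  finally have v_t: "partial_t v p = poly P (u p) * partial_t u p" .
  \<comment> \<open>No product rule is applied: the outer derivative stays unevaluated, and the
    product inside it is already the i-th component of P(u) \<nabla>u, so summing over i gives the
    divergence.\<close>
  have "partial_x i (partial_x i v) p = partial_x i (\<lambda>q. poly P (u q) * partial_x i u q) p" for i
    using \<open>open \<Omega>\<close> p v_x by (rule partial_x_cong)
  then have "laplacian_x v p = div_x (\<lambda>q. poly P (u q) *\<^sub>R grad_x u q) p"
    by (simp add: laplacian_x_def div_x_def grad_x_def)
  moreover have "D (v p) = poly P (u p)"
    using D[OF u_nonneg[OF p]] v_eq[OF p] by simp
  ultimately show "partial_t v p - D (v p) * laplacian_x v p
        = partial_t v p - poly P (u p) * laplacian_x v p \<and>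
      partial_t v p - poly P (u p) * laplacian_x v p
        = poly P (u p) * (partial_t u p - div_x (\<lambda>q. poly P (u q) *\<^sub>R grad_x u q) p)"
    by (simp add: v_t right_diff_distrib)
qed

end
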